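(* Let $n>1$ be an odd integer and let $k\in\mathbb{Z}$. Then the polynomial $$f_{n,k}(x)=k\sum_{j\geq 0}\binom{n-1}{2j+1}(x^j-x^{j+1})+2\sum_{j\geq 0}\binom{n}{2j}x^j\in\mathbb{Z}[x]$$ is self-reciprocal if and only if either $k=1$, or $k=3$ and $n=3$.
   Context: Binomial coefficients $\binom{a}{b}$ are $0$ when $b>a$. A nonzero polynomial $f(x)$ of (actual) degree $d\ge 0$ is called self-reciprocal if $x^d f(1/x)=f(x)$, i.e. if $f(x)=\sum_{i=0}^d a_ix^i$ with $a_d\neq 0$ then $a_i=a_{d-i}$ for all $0\le i\le d$. Nonzero constant polynomials count as self-reciprocal. *)

theory Defs
  imports "HOL-Computational_Algebra.Polynomial"
begin

text \<open>\<open>reflect_poly p\<close> is $x^d p(1/x)$ for the actual degree \<open>d\<close> of \<open>p\<close>; the zero polynomial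
  is excluded explicitly because it is also fixed by \<open>reflect_poly\<close>.\<close>

definition self_reciprocal :: "'a::zero poly \<Rightarrow> bool" where
  "self_reciprocal p \<longleftrightarrow> p \<noteq> 0 \<and> reflect_poly p = p"

lemma self_reciprocal_iff_coeff:
  "self_reciprocal p \<longleftrightarrow> p \<noteq> 0 \<and> (\<forall>i\<le>degree p. coeff p i = coeff p (degree p - i))"
proof -
  have "reflect_poly p = p \<longleftrightarrow> (\<forall>i\<le>degree p. coeff p i = coeff p (degree p - i))"
  proof
    assume eq: "reflect_poly p = p"
    show "\<forall>i\<le>degree p. coeff p i = coeff p (degree p - i)"
    proof (intro allI impI)
      fix i assume "i \<le> degree p"
      have "coeff p i = coeff (reflect_poly p) i"
        by (simp only: eq)
      also have "\<dots> = coeff p (degree p - i)"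
        using \<open>i \<le> degree p\<close> by (simp add: coeff_reflect_poly)
      finally show "coeff p i = coeff p (degree p - i)" .
    qed
  next
    assume sym: "\<forall>i\<le>degree p. coeff p i = coeff p (degree p - i)"
    show "reflect_poly p = p"
    proof (rule poly_eqI)
      fix i
      show "coeff (reflect_poly p) i = coeff p i"
      proof (cases "i \<le> degree p")
        case True
        then show ?thesis using sym[rule_format, OF True] by (simp only: coeff_reflect_poly not_less if_not_P)
      next
        case False
        then show ?thesis by (simp add: coeff_reflect_poly coeff_eq_0)
      qed
    qed
  qed
  then show ?thesis
    by (simp only: self_reciprocal_def)
qed

text \<open>The sums over all \<open>j \<ge> 0\<close> are cut off at \<open>j = n\<close>, beyond which every binomial
  coefficient occurring in them is zero.\<close>

definition f_poly :: "nat \<Rightarrow> int \<Rightarrow> int poly" where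
  "f_poly n k =
     smult k (\<Sum>j\<le>n. smult (of_nat ((n - 1) choose (2 * j + 1))) (monom 1 j - monom 1 (j + 1)))
     + smult 2 (\<Sum>j\<le>n. smult (of_nat (n choose (2 * j))) (monom 1 j))"

end

theory Submission
  imports Defs
begin

text \<open>Write \<open>n = 2 * m + 1\<close>. The coefficients of \<open>x^0\<close> and \<open>x^m\<close> are \<open>2 * m * k + 2\<close> and
  \<open>2 * (2 * m + 1) - 2 * m * k\<close>. If the latter is nonzero, the degree is \<open>m\<close> and comparing the two
  gives \<open>k = 1\<close>; if it vanishes, \<open>m\<close> divides 1, so \<open>m = 1\<close>, \<open>k = 3\<close> and the polynomial is
  constant. For \<open>k = 1\<close>, Pascal's rule turns the coefficient of \<open>x^j\<close> into
  \<open>2 * m + 2 choose (2 * j + 1)\<close>, which is symmetric under \<open>j \<mapsto> m - j\<close>.\<close>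

text \<open>The term \<open>monom 1 (i + 1)\<close> meets \<open>x^j\<close> at
  \<open>i = j - 1\<close>, hence the lower index \<open>2 * j - 1\<close>. The case
  \<open>j = 0\<close> is split off because truncated subtraction would give
  \<open>(n - 1) choose 0 = 1\<close> there.\<close>

lemma coeff_f_poly:
  assumes "n > 0"
  shows "coeff (f_poly n k) j =
    k * (int ((n - 1) choose (2 * j + 1)) - (if j = 0 then 0 else int ((n - 1) choose (2 * j - 1))))
    + 2 * int (n choose (2 * j))"
proof -
  have A: "(\<Sum>i\<le>n. int ((n - 1) choose (2 * i + 1)) * (if i = j then 1 else 0))
      = int ((n - 1) choose (2 * j + 1))"
    by (cases "j \<le> n") (auto simp: if_distrib[of "\<lambda>x. _ * x"] binomial_eq_0 cong: if_cong)
  have C: "(\<Sum>i\<le>n. int (n choose (2 * i)) * (if i = j then 1 else 0)) = int (n choose (2 * j))"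
    by (cases "j \<le> n") (auto simp: if_distrib[of "\<lambda>x. _ * x"] binomial_eq_0 cong: if_cong)
  have B: "(\<Sum>i\<le>n. int ((n - 1) choose (2 * i + 1)) * (if i + 1 = j then 1 else 0))
      = (if j = 0 then 0 else int ((n - 1) choose (2 * j - 1)))"
  proof (cases j)
    case (Suc l)
    then show ?thesis
      by (cases "l \<le> n") (auto simp: if_distrib[of "\<lambda>x. _ * x"] binomial_eq_0 cong: if_cong)
  qed simp
  show ?thesis
    unfolding f_poly_def using A B C
    by (simp add: coeff_sum right_diff_distrib sum_subtractf del: Suc_eq_plus1 mult_cancel_left1)
qed

text \<open>For \<open>j > m\<close> even the smallest lower index \<open>2 * j - 1\<close> exceeds
  \<open>n - 1 = 2 * m\<close>, and \<open>2 * j > n\<close>.\<close>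

lemma degree_f_poly_le:
  assumes "n = 2 * m + 1"
  shows "degree (f_poly n k) \<le> m"
  using assms by (intro degree_le) (auto simp: coeff_f_poly binomial_eq_0)

lemma coeff_f_poly_0:
  assumes "n = 2 * m + 1"
  shows "coeff (f_poly n k) 0 = 2 * int m * k + 2"
  using assms by (simp add: coeff_f_poly)

lemma coeff_f_poly_top:
  assumes "n = 2 * m + 1" and "m > 0"
  shows "coeff (f_poly n k) m = 2 * (2 * int m + 1) - 2 * int m * k"
proof -
  have "(2 * m) choose (2 * m - 1) = 2 * m"
    using binomial_symmetric[of 1 "2 * m"] assms by simp
  then show ?thesis
    using assms by (simp add: coeff_f_poly binomial_eq_0)
qed

lemma coeff_f_poly_one:
  assumes "n = 2 * m + 1"
  shows "coeff (f_poly n 1) j = int ((2 * m + 2) choose (2 * j + 1))"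
proof (cases j)
  case 0
  then show ?thesis using assms by (simp add: coeff_f_poly)
next
  case (Suc l)
  \<comment> \<open>With \<open>j = Suc l\<close>, Pascal's rule reduces both sides to
    \<open>2 * m choose r\<close> with weights 1, 2, 1 at
    \<open>r = 2 * j - 1, 2 * j, 2 * j + 1\<close>.\<close>
  then show ?thesis using assms by (simp add: coeff_f_poly)
qed

lemma self_reciprocal_f_poly_one:
  assumes "n = 2 * m + 1"
  shows "self_reciprocal (f_poly n 1)"
proof -
  have "coeff (f_poly n 1) m \<noteq> 0"
    using assms by (simp add: coeff_f_poly_one)
  then have ne: "f_poly n 1 \<noteq> 0" and deg: "degree (f_poly n 1) = m"
    using degree_f_poly_le[OF assms, of 1] by (auto intro: antisym le_degree)
  \<comment> \<open>The complement of \<open>2 * i + 1\<close> in \<open>2 * m + 2\<close> is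
    \<open>2 * (m - i) + 1\<close>.\<close>
  have "(2 * m + 2) choose (2 * i + 1) = (2 * m + 2) choose (2 * (m - i) + 1)" if "i \<le> m" for i
    using binomial_symmetric[of "2 * i + 1" "2 * m + 2"] that
    by (simp add: Suc_diff_le diff_mult_distrib2)
  then show ?thesis
    unfolding self_reciprocal_iff_coeff deg coeff_f_poly_one[OF assms] using ne by metis
qed

theorem theorem2p4:
  fixes n :: nat and k :: int
  assumes "n > 1" and "odd n"
  shows "self_reciprocal (f_poly n k) \<longleftrightarrow> k = 1 \<or> (k = 3 \<and> n = 3)"
proof -
  obtain m where n: "n = 2 * m + 1"
    using \<open>odd n\<close> by (rule oddE)
  have m: "m > 0" using \<open>n > 1\<close> n by simp
  note deg = degree_f_poly_le[OF n, of k]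
    and bottom = coeff_f_poly_0[OF n, of k]
    and top = coeff_f_poly_top[OF n m, of k]
  show ?thesis
  proof
    assume sr: "self_reciprocal (f_poly n k)"
    show "k = 1 \<or> (k = 3 \<and> n = 3)"
    proof (cases "coeff (f_poly n k) m = 0")
      case True
      then have eq: "int m * (k - 2) = 1"
        using top by (simp add: algebra_simps)
      then have "m = 1"
        using m by (simp add: zmult_eq_1_iff)
      then show ?thesis using eq n by simp
    next
      case False
      then have "degree (f_poly n k) = m"
        using deg by (auto intro: antisym le_degree)
      then have "coeff (f_poly n k) 0 = coeff (f_poly n k) m"
        using sr by (metis self_reciprocal_iff_coeff diff_zero le0)
      then have "int m * (k - 1) = 0"
        using top bottom by (simp add: algebra_simps)
      then show ?thesis using m by simp
    qed
  next
    assume "k = 1 \<or> (k = 3 \<and> n = 3)"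
    then show "self_reciprocal (f_poly n k)"
    proof
      assume "k = 1"
      then show ?thesis using self_reciprocal_f_poly_one[OF n] by simp
    next
      assume k: "k = 3 \<and> n = 3"
      then have "m = 1" using n by simp
      \<comment> \<open>The top coefficient is \<open>2 * 3 - 2 * 3\<close>, so only the constant
        term 8 remains.\<close>
      then have "coeff (f_poly n k) 1 = 0"
        using top k by simp
      then have "degree (f_poly n k) = 0"
        using deg \<open>m = 1\<close> by (metis One_nat_def le_Suc_eq le_zero_eq leading_coeff_0_iff degree_0)
      moreover have "f_poly n k \<noteq> 0"
        using bottom k by auto
      ultimately show ?thesis
        by (simp add: self_reciprocal_iff_coeff)
    qed
  qed
qed

end
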